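(* For all $n,m \in \mathbb{N}=\{0,1,2,\ldots\}$ with $n \neq m$, $$N_{n,m} = \int_0^1 P_n(2x-1)\,P_m(2x-1)\,\log(x)\,dx = \frac{(-1)^{n+m+1}}{|n-m|\,(n+m+1)}.$$
   Context: The Legendre polynomials $P_0,P_1,P_2,\ldots$ are defined by $P_0(x)=1$, $P_1(x)=x$, and for $n\geq 1$ by the three-term recurrence $(n+1)P_{n+1}(x) = (2n+1)\,x\,P_n(x) - n\,P_{n-1}(x)$. For $n,m\in\mathbb{N}$ define $N_{n,m} := \int_0^1 P_n(2x-1)\,P_m(2x-1)\,\log(x)\,dx$, where $\log$ is the natural logarithm. Here $\mathbb{N}$ includes $0$. *)

theory Defs
  imports "HOL-Analysis.Analysis" "HOL-Computational_Algebra.Polynomial"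
begin

text \<open>
  The three-term recurrence, shifted by one and solved for the leading term; the recurrence in its
  usual form is the lemma following the definition.
\<close>

fun legendre_poly :: "nat \<Rightarrow> real poly" where
  "legendre_poly 0 = 1"
| "legendre_poly (Suc 0) = [:0, 1:]"
| "legendre_poly (Suc (Suc n)) =
     smult (1 / (real n + 2))
       (smult (2 * real n + 3) ([:0, 1:] * legendre_poly (Suc n))
        - smult (real n + 1) (legendre_poly n))"

lemma legendre_poly_recurrence:
  assumes "n \<ge> 1"
  shows "(real n + 1) * poly (legendre_poly (n + 1)) x =
           (2 * real n + 1) * x * poly (legendre_poly n) x
           - real n * poly (legendre_poly (n - 1)) x"
proof -
  obtain k where k: "n = Suc k"
    using assms by (cases n) auto
  have "real k + 2 \<noteq> 0"
    by simp
  then show ?thesis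
    by (simp add: k field_simps)
qed

definition legendre_log_integral :: "nat \<Rightarrow> nat \<Rightarrow> real" where
  "legendre_log_integral n m =
     (LBINT x=0..1. poly (legendre_poly n) (2 * x - 1) * poly (legendre_poly m) (2 * x - 1) * ln x)"

end

theory Submission
  imports Defs "HOL-Real_Asymp.Real_Asymp"
begin

text \<open>
  Let \<open>q\<^sub>n(x) = P\<^sub>n(2x - 1)\<close>. Legendre's equation reads \<open>(x(x - 1) q\<^sub>n')' = n(n + 1) q\<^sub>n\<close>, so with
  \<open>W = q\<^sub>n' q\<^sub>m - q\<^sub>m' q\<^sub>n\<close> the function \<open>x(x - 1) W ln x\<close>, which vanishes at both endpoints, has
  derivative \<open>(n(n + 1) - m(m + 1)) q\<^sub>n q\<^sub>m ln x + (x - 1) W\<close>. Hence \<open>(n - m)(n + m + 1) N\<^sub>n\<^sub>m\<close>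
  equals \<open>- \<integral> (x - 1) W\<close>. For \<open>n > m\<close>, integrating by parts and using that \<open>q\<^sub>n\<close> is orthogonal to
  all polynomials of degree less than \<open>n\<close> leaves only the boundary term
  \<open>- q\<^sub>n(0) q\<^sub>m(0) = (-1)\<^sup>n\<^sup>+\<^sup>m\<^sup>+\<^sup>1\<close>.
\<close>

section \<open>Derivative relations and Legendre's equation\<close>

lemma poly_legendre_Suc_Suc:
  "(real n + 2) * poly (legendre_poly (Suc (Suc n))) x =
     (2 * real n + 3) * x * poly (legendre_poly (Suc n)) x - (real n + 1) * poly (legendre_poly n) x"
proof -
  have "real n + 2 \<noteq> 0" by simp
  then show ?thesis by (simp add: field_simps)
qed

lemma poly_pderiv_legendre_Suc_Suc:
  "(real n + 2) * poly (pderiv (legendre_poly (Suc (Suc n)))) x =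
     (2 * real n + 3) * (poly (legendre_poly (Suc n)) x + x * poly (pderiv (legendre_poly (Suc n))) x)
     - (real n + 1) * poly (pderiv (legendre_poly n)) x"
proof -
  have "real n + 2 \<noteq> 0" by simp
  then show ?thesis
    by (simp add: pderiv_smult pderiv_diff pderiv_mult pderiv_add pderiv_pCons field_simps)
qed

text \<open>The two relations are coupled, hence one joint induction. The differentiated recurrence
  with \<open>P_n'\<close> eliminated by the second relation gives the first one for the next index;
  this, both hypotheses and the recurrence itself then give the second one.\<close>

lemma pderiv_legendre_relations:
  "poly (pderiv (legendre_poly (Suc n))) x =
     x * poly (pderiv (legendre_poly n)) x + (real n + 1) * poly (legendre_poly n) x \<and>
   x * poly (pderiv (legendre_poly (Suc n))) x - poly (pderiv (legendre_poly n)) x =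
     (real n + 1) * poly (legendre_poly (Suc n)) x"
proof (induction n)
  case 0
  show ?case by (simp add: pderiv_pCons)
next
  case (Suc n)
  define a b c where "a = poly (legendre_poly n) x" and "b = poly (legendre_poly (Suc n)) x"
    and "c = poly (legendre_poly (Suc (Suc n))) x"
  define a' b' c' where "a' = poly (pderiv (legendre_poly n)) x"
    and "b' = poly (pderiv (legendre_poly (Suc n))) x"
    and "c' = poly (pderiv (legendre_poly (Suc (Suc n)))) x"
  have 1: "b' = x * a' + (real n + 1) * a" and 2: "x * b' - a' = (real n + 1) * b"
    using Suc unfolding a_def b_def a'_def b'_def by auto
  have 3: "(real n + 2) * c = (2 * real n + 3) * x * b - (real n + 1) * a"
    unfolding a_def b_def c_def by (rule poly_legendre_Suc_Suc)
  have 4: "(real n + 2) * c' = (2 * real n + 3) * (b + x * b') - (real n + 1) * a'"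
    unfolding b_def a'_def b'_def c'_def by (rule poly_pderiv_legendre_Suc_Suc)
  have "(real n + 2) * c' = (real n + 2) * (x * b' + (real n + 2) * b)"
    using 2 4 by algebra
  then have 5: "c' = x * b' + (real n + 2) * b"
    by simp
  have "x * c' - b' = (real n + 2) * c"
    using 1 2 3 5 by algebra
  with 5 have "c' = x * b' + (real (Suc n) + 1) * b \<and> x * c' - b' = (real (Suc n) + 1) * c"
    by (simp add: algebra_simps)
  then show ?case
    unfolding b_def c_def b'_def c'_def .
qed

text \<open>For n = k + 1, eliminating \<open>P_k'\<close> from the two derivative relations gives
  (x^2 - 1) \<open>P_n'\<close> = n (x \<open>P_n\<close> - \<open>P_k\<close>). Differentiating
  this and applying the second relation once more gives the equation.\<close>

lemma legendre_ode:
  "pderiv ([:-1, 0, 1:] * pderiv (legendre_poly n)) =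
     smult (real n * (real n + 1)) (legendre_poly n)"
proof (cases n)
  case 0
  then show ?thesis by simp
next
  case (Suc k)
  let ?P = "legendre_poly k" and ?Q = "legendre_poly (Suc k)"
  have "poly ([:-1, 0, 1:] * pderiv ?Q) x = poly (smult (real k + 1) ([:0, 1:] * ?Q - ?P)) x" for x
  proof -
    have "(x * x - 1) * poly (pderiv ?Q) x = (real k + 1) * (x * poly ?Q x - poly ?P x)"
      using pderiv_legendre_relations[of k x] by algebra
    then show ?thesis
      by (simp add: algebra_simps del: legendre_poly.simps)
  qed
  then have *: "[:-1, 0, 1:] * pderiv ?Q = smult (real k + 1) ([:0, 1:] * ?Q - ?P)"
    by (intro iffD1[OF poly_eq_poly_eq_iff] ext)
  have "poly (pderiv ([:-1, 0, 1:] * pderiv ?Q)) x =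
          poly (smult ((real k + 1) * (real k + 2)) ?Q) x" for x
  proof -
    have "poly (pderiv ([:-1, 0, 1:] * pderiv ?Q)) x =
        (real k + 1) * (poly ?Q x + x * poly (pderiv ?Q) x - poly (pderiv ?P) x)"
      unfolding *
      by (simp add: pderiv_smult pderiv_diff pderiv_mult pderiv_pCons algebra_simps
          del: legendre_poly.simps)
    also have "\<dots> = (real k + 1) * (real k + 2) * poly ?Q x"
      using pderiv_legendre_relations[of k x] by algebra
    finally show ?thesis by simp
  qed
  then have "pderiv ([:-1, 0, 1:] * pderiv ?Q) = smult ((real k + 1) * (real k + 2)) ?Q"
    by (intro iffD1[OF poly_eq_poly_eq_iff] ext)
  then show ?thesis
    by (simp add: Suc add.commute del: legendre_poly.simps)
qed

lemma poly_legendre_minus_one: "poly (legendre_poly n) (-1) = (-1) ^ n"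
proof (induction n rule: legendre_poly.induct)
  case (3 n)
  have "(real n + 2) * poly (legendre_poly (Suc (Suc n))) (-1) = (real n + 2) * (-1) ^ Suc (Suc n)"
    unfolding poly_legendre_Suc_Suc 3 by (simp add: algebra_simps)
  then show ?case
    by (simp del: legendre_poly.simps power_Suc)
qed auto

lemma degree_legendre_poly_le: "degree (legendre_poly n) \<le> n"
proof (induction n rule: legendre_poly.induct)
  case (3 n)
  have "degree ([:0, 1:] * legendre_poly (Suc n)) \<le> Suc (Suc n)"
    using degree_mult_le[of "[:0, 1:]" "legendre_poly (Suc n)"] 3 by simp
  then show ?case
    using 3 by (auto intro!: degree_diff_le order.trans[OF degree_smult_le] simp del: mult_pCons_left)
qed auto

section \<open>Transfer to the unit interval\<close>

definition shifted_legendre :: "nat \<Rightarrow> real poly" where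
  "shifted_legendre n = pcompose (legendre_poly n) [:-1, 2:]"

lemma poly_shifted_legendre: "poly (shifted_legendre n) x = poly (legendre_poly n) (2 * x - 1)"
  by (simp add: shifted_legendre_def poly_pcompose algebra_simps)

lemma poly_shifted_legendre_0: "poly (shifted_legendre n) 0 = (-1) ^ n"
  by (simp add: poly_shifted_legendre poly_legendre_minus_one)

lemma degree_shifted_legendre_le: "degree (shifted_legendre n) \<le> n"
  using degree_pcompose_le[of "legendre_poly n" "[:-1, 2:]"] degree_legendre_poly_le[of n]
  by (simp add: shifted_legendre_def)

text \<open>The substitution y = 2x - 1 turns y^2 - 1 into 4x(x - 1), and the factor 4 cancels
  against the two factors 2 that the chain rule produces.\<close>

lemma shifted_legendre_ode:
  "pderiv ([:0, -1, 1:] * pderiv (shifted_legendre n)) =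
     smult (real n * (real n + 1)) (shifted_legendre n)"
proof -
  let ?c = "[:-1, 2:] :: real poly" and ?P = "legendre_poly n"
  have D: "pderiv ?c = 2"
    by (simp add: pderiv_pCons numeral_poly)
  have C: "pcompose [:-1, 0, 1:] ?c = 4 * [:0, -1, 1:]"
    by (simp add: pcompose_pCons numeral_poly)
  have "pcompose (pderiv ([:-1, 0, 1:] * pderiv ?P)) ?c * 2 =
          pderiv (pcompose ([:-1, 0, 1:] * pderiv ?P) ?c)"
    by (simp add: pderiv_pcompose D)
  also have "pcompose ([:-1, 0, 1:] * pderiv ?P) ?c =
               2 * ([:0, -1, 1:] * pderiv (shifted_legendre n))"
    unfolding pcompose_mult C shifted_legendre_def pderiv_pcompose D by algebra
  also have "pderiv \<dots> = 2 * pderiv ([:0, -1, 1:] * pderiv (shifted_legendre n))"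
    by (simp only: mult_2 pderiv_add)
  finally have "pderiv ([:0, -1, 1:] * pderiv (shifted_legendre n)) =
      pcompose (pderiv ([:-1, 0, 1:] * pderiv ?P)) ?c"
    by simp
  then show ?thesis
    unfolding legendre_ode by (simp add: pcompose_smult shifted_legendre_def)
qed

section \<open>Integrals of polynomials and orthogonality\<close>

text \<open>Taking a polynomial as argument makes the integral a linear functional on
  \<open>real poly\<close>, so that polynomial identities can be integrated without integrability
  side conditions.\<close>

definition unit_integral :: "real poly \<Rightarrow> real" where
  "unit_integral p = (LBINT x=0..1. poly p x)"

lemma interval_integrable_poly: "interval_lebesgue_integrable lborel 0 1 (poly p)" for p :: "real poly"
  using interval_integrable_isCont[of 0 1 "poly p"] by (simp add: zero_ereal_def one_ereal_def)

lemma unit_integral_add: "unit_integral (p + q) = unit_integral p + unit_integral q"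
  using interval_lebesgue_integral_add(2)[OF interval_integrable_poly interval_integrable_poly]
  by (simp add: unit_integral_def)

lemma unit_integral_diff: "unit_integral (p - q) = unit_integral p - unit_integral q"
  using interval_lebesgue_integral_diff(2)[OF interval_integrable_poly interval_integrable_poly]
  by (simp add: unit_integral_def)

lemma unit_integral_smult: "unit_integral (smult c p) = c * unit_integral p"
  by (simp add: unit_integral_def)

lemma unit_integral_0: "unit_integral 0 = 0"
  using unit_integral_smult[of 0 0] by simp

lemma unit_integral_sum: "unit_integral (\<Sum>i\<in>A. f i) = (\<Sum>i\<in>A. unit_integral (f i))"
  by (induction A rule: infinite_finite_induct) (auto simp: unit_integral_0 unit_integral_add)

lemma unit_integral_pderiv: "unit_integral (pderiv p) = poly p 1 - poly p 0"
  unfolding unit_integral_def zero_ereal_def one_ereal_def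
  by (rule interval_integral_FTC_finite)
     (auto intro!: continuous_intros DERIV_subset[OF poly_DERIV]
        simp flip: has_real_derivative_iff_has_vector_derivative)

text \<open>The operator L r = (x(x - 1) r')' is self-adjoint on [0,1], has
  \<open>shifted_legendre n\<close> as an eigenvector, and acts triangularly on monomials: it maps
  x^j to j(j + 1) x^j - j^2 x^(j-1). Comparing eigenvalues reduces each power to the one below
  it.\<close>

lemma unit_integral_shifted_legendre_monom:
  assumes "k < n"
  shows "unit_integral (shifted_legendre n * monom 1 k) = 0"
  using assms
proof (induction k)
  case (0)
  let ?q = "shifted_legendre n" and ?D = "[:0, -1, 1:] :: real poly"
  \<comment> \<open>\<open>?D\<close> is x(x - 1), so the boundary terms at 0 and 1 vanish.\<close>
  have "0 = unit_integral (pderiv (?D * pderiv ?q))"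
    by (simp add: unit_integral_pderiv)
  also have "\<dots> = real n * (real n + 1) * unit_integral ?q"
    unfolding shifted_legendre_ode unit_integral_smult ..
  finally show ?case using 0 by (simp add: monom_0 flip: one_pCons)
next
  case (Suc k)
  let ?q = "shifted_legendre n" and ?D = "[:0, -1, 1:] :: real poly"
  let ?r = "monom 1 (Suc k) :: real poly"
  let ?l = "real n * (real n + 1)" and ?m = "(real k + 1) * (real k + 2)"
  have D: "pderiv (?D * pderiv ?r) = smult ?m ?r - smult ((real k + 1)\<^sup>2) (monom 1 k)"
  proof -
    have "?D * pderiv ?r = monom (real k + 1) (Suc (Suc k)) - monom (real k + 1) (Suc k)"
    proof -
      have "?D = monom 1 (Suc (Suc 0)) - monom 1 (Suc 0)"
        by (simp add: monom_Suc monom_0)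
      then show ?thesis
        by (simp add: pderiv_monom left_diff_distrib mult_monom add.commute del: mult_pCons_left)
    qed
    then show ?thesis
      by (simp add: pderiv_diff pderiv_monom smult_monom power2_eq_square add.commute mult.commute
          del: mult_pCons_left)
  qed
  \<comment> \<open>Lagrange's identity: the boundary terms again carry the factor
    \<open>?D\<close>, and the mixed products of first derivatives cancel.\<close>
  have "0 = unit_integral (pderiv (?D * pderiv ?q * ?r - ?D * pderiv ?r * ?q))"
    by (simp add: unit_integral_pderiv)
  also have "pderiv (?D * pderiv ?q * ?r - ?D * pderiv ?r * ?q) =
      pderiv (?D * pderiv ?q) * ?r - pderiv (?D * pderiv ?r) * ?q"
    unfolding pderiv_diff pderiv_mult[of "?D * pderiv ?q"] pderiv_mult[of "?D * pderiv ?r"] by algebra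
  also have "\<dots> = smult (?l - ?m) (?q * ?r) + smult ((real k + 1)\<^sup>2) (?q * monom 1 k)"
    unfolding shifted_legendre_ode D
    by (simp add: algebra_simps smult_diff_left smult_add_left smult_diff_right)
  also have "unit_integral \<dots> = (?l - ?m) * unit_integral (?q * ?r)"
    using Suc by (simp add: unit_integral_add unit_integral_smult)
  finally have "(?l - ?m) * unit_integral (?q * ?r) = 0"
    by simp
  \<comment> \<open>The eigenvalues differ precisely because \<open>Suc k < n\<close>.\<close>
  moreover have "?l - ?m = (real n - real (Suc k)) * (real n + real k + 2)"
    by (simp add: algebra_simps)
  moreover have "real n - real (Suc k) \<noteq> 0" "real n + real k + 2 \<noteq> 0"
    using Suc.prems by auto
  ultimately show ?case
    by simp
qed

lemma unit_integral_shifted_legendre_orthogonal: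
  assumes "degree r < n"
  shows "unit_integral (shifted_legendre n * r) = 0"
proof -
  have "shifted_legendre n * r =
      (\<Sum>i\<le>degree r. smult (coeff r i) (shifted_legendre n * monom 1 i))"
    by (subst poly_as_sum_of_monoms[of r, symmetric])
       (simp add: sum_distrib_left smult_monom flip: mult_smult_right)
  then show ?thesis
    using assms by (simp add: unit_integral_sum unit_integral_smult unit_integral_shifted_legendre_monom)
qed

text \<open>Subtracting the integrand from the derivative of (x - 1) \<open>?q\<close>
  \<open>?r\<close> leaves \<open>?q\<close> times a polynomial of degree at most m < n, whose
  integral vanishes by orthogonality. The boundary term is zero at 1 because of the factor x - 1,
  and at 0 it is the product of the two values there.\<close>

lemma unit_integral_wronskian:
  assumes "m < n"
  shows "unit_integral ([:-1, 1:] * (pderiv (shifted_legendre n) * shifted_legendre m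
           - pderiv (shifted_legendre m) * shifted_legendre n)) = (-1) ^ (n + m)"
proof -
  let ?q = "shifted_legendre n" and ?r = "shifted_legendre m" and ?c = "[:-1, 1:] :: real poly"
  have "?c * (pderiv ?q * ?r - pderiv ?r * ?q) =
      pderiv (?c * ?q * ?r) - ?q * (?r + smult 2 (?c * pderiv ?r))"
  proof -
    have "pderiv ?c = 1"
      by (simp add: pderiv_pCons one_pCons)
    moreover have "smult 2 (?c * pderiv ?r) = 2 * (?c * pderiv ?r)"
      by (simp add: numeral_poly)
    ultimately show ?thesis
      unfolding pderiv_mult by algebra
  qed
  \<comment> \<open>The case m = 0 is separate: there the general bound 1 +
    \<open>degree (pderiv ?r)\<close> would be 1, while the product is actually zero.\<close>
  moreover have "degree (?c * pderiv ?r) \<le> m"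
  proof (cases m)
    case 0
    then have "pderiv ?r = 0"
      using degree_shifted_legendre_le[of m] by (simp add: pderiv_eq_0_iff)
    then show ?thesis by simp
  next
    case (Suc k)
    then show ?thesis
      using degree_mult_le[of ?c "pderiv ?r"] degree_shifted_legendre_le[of m]
      by (simp add: degree_pderiv)
  qed
  then have "degree (?r + smult 2 (?c * pderiv ?r)) < n"
    using assms degree_shifted_legendre_le[of m]
    by (intro le_less_trans[OF degree_add_le assms] order.trans[OF degree_smult_le])
  ultimately show ?thesis
    by (simp add: unit_integral_diff unit_integral_pderiv unit_integral_shifted_legendre_orthogonal
        poly_shifted_legendre_0 power_add)
qed

section \<open>Integration against the logarithm\<close>

text \<open>On (0,1) the function - ln x is nonnegative, and its antiderivative x - x ln x has
  finite limits at both ends, so it is integrable. A polynomial is bounded on [0,1], and domination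
  gives the general case.\<close>

lemma interval_integrable_poly_ln:
  "interval_lebesgue_integrable lborel 0 1 (\<lambda>x. poly p x * ln x)" for p :: "real poly"
proof -
  have "set_integrable lborel (einterval 0 1) (\<lambda>x. - ln x)"
  proof (rule interval_integral_FTC_nonneg(1)[where F = "\<lambda>x. x - x * ln x" and A = 0 and B = 1])
    fix x :: real assume "0 < ereal x" "ereal x < 1"
    then have x: "0 < x" "x < 1" by (auto simp: zero_ereal_def one_ereal_def)
    show "((\<lambda>x. x - x * ln x) has_real_derivative - ln x) (at x)"
      using x by (auto intro!: derivative_eq_intros)
    show "isCont (\<lambda>x. - ln x) x"
      using x by (auto intro!: continuous_intros)
  next
    show "AE x in lborel. 0 < ereal x \<longrightarrow> ereal x < 1 \<longrightarrow> 0 \<le> - ln x"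
      by (auto simp: zero_ereal_def one_ereal_def)
  next
    have "((\<lambda>x::real. x - x * ln x) \<longlongrightarrow> 0) (at_right 0)" by real_asymp
    then show "(((\<lambda>x. x - x * ln x) \<circ> real_of_ereal) \<longlongrightarrow> 0) (at_right 0)"
      by (simp add: ereal_tendsto_simps zero_ereal_def)
    have "((\<lambda>x::real. x - x * ln x) \<longlongrightarrow> 1) (at_left 1)" by real_asymp
    then show "(((\<lambda>x. x - x * ln x) \<circ> real_of_ereal) \<longlongrightarrow> 1) (at_left 1)"
      by (simp add: ereal_tendsto_simps one_ereal_def)
  qed auto
  then have ln: "set_integrable lborel {0<..<1} (\<lambda>x::real. ln x)"
    by (simp add: zero_ereal_def one_ereal_def set_integrable_def)
  have "bounded (poly p ` {0..1})"
    by (intro compact_imp_bounded compact_continuous_image continuous_intros) auto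
  then obtain C where "\<forall>x\<in>{0..1}. \<bar>poly p x\<bar> \<le> C"
    unfolding bounded_iff by auto
  then have C: "\<bar>poly p x\<bar> \<le> C" if "x \<in> {0..1}" for x
    using that by blast
  have "set_integrable lborel {0<..<1} (\<lambda>x. poly p x * ln x)"
  proof (rule set_integrable_bound)
    show "set_integrable lborel {0<..<1} (\<lambda>x. C * ln x)"
      using ln by simp
    have [measurable]: "poly p \<in> borel_measurable borel"
      by (intro borel_measurable_continuous_onI continuous_intros)
    show "set_borel_measurable lborel {0<..<1} (\<lambda>x. poly p x * ln x)"
      unfolding set_borel_measurable_def by simp
    show "AE x in lborel. x \<in> {0<..<1} \<longrightarrow> norm (poly p x * ln x) \<le> norm (C * ln x)"
    proof (intro always_eventually allI impI)
      fix x :: real assume "x \<in> {0<..<1}"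
      then have "\<bar>poly p x\<bar> \<le> \<bar>C\<bar>" using C[of x] by auto
      then show "norm (poly p x * ln x) \<le> norm (C * ln x)"
        by (auto simp: abs_mult intro: mult_right_mono)
    qed
  qed
  then show ?thesis
    by (simp add: interval_lebesgue_integrable_def zero_ereal_def one_ereal_def)
qed

text \<open>This is integration by parts with antiderivative x(x - 1) \<open>w\<close> ln x: the 1/x
  from the logarithm cancels the factor x, and both boundary limits are zero.\<close>

lemma integral_pderiv_ln:
  "(LBINT x=0..1. poly (pderiv ([:0, -1, 1:] * w)) x * ln x) = - unit_integral ([:-1, 1:] * w)"
proof -
  let ?D = "[:0, -1, 1:] :: real poly" and ?c = "[:-1, 1:] :: real poly"
  have sum: "interval_lebesgue_integrable lborel 0 1
          (\<lambda>x. poly (pderiv (?D * w)) x * ln x + poly (?c * w) x)"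
    by (intro interval_lebesgue_integral_add(1) interval_integrable_poly_ln interval_integrable_poly)
  have "(LBINT x=0..1. poly (pderiv (?D * w)) x * ln x + poly (?c * w) x) = 0 - 0"
  proof (rule interval_integral_FTC_integrable[where F = "\<lambda>x. poly (?D * w) x * ln x"])
    fix x :: real assume "0 < ereal x" "ereal x < 1"
    then have x: "0 < x" by (auto simp: zero_ereal_def)
    have "poly (?D * w) x / x = poly (?c * w) x"
      using x by (simp add: field_simps)
    then have "((\<lambda>x. poly (?D * w) x * ln x) has_real_derivative
        poly (pderiv (?D * w)) x * ln x + poly (?c * w) x) (at x)"
      using DERIV_mult[OF poly_DERIV[of "?D * w" x] DERIV_ln_divide[OF x]]
      by (simp add: add.commute del: mult_pCons_left)
    then show "((\<lambda>x. poly (?D * w) x * ln x) has_vector_derivative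
        poly (pderiv (?D * w)) x * ln x + poly (?c * w) x) (at x)"
      by (simp add: has_real_derivative_iff_has_vector_derivative)
    show "isCont (\<lambda>x. poly (pderiv (?D * w)) x * ln x + poly (?c * w) x) x"
      using x by (intro continuous_intros) auto
  next
    \<comment> \<open>One factor x of \<open>?D\<close> is paired with the logarithm; the remaining
      factor \<open>?c * w\<close> is continuous at 0.\<close>
    have "((\<lambda>x::real. x * ln x) \<longlongrightarrow> 0) (at_right 0)" by real_asymp
    moreover have "(poly (?c * w) \<longlongrightarrow> poly (?c * w) 0) (at_right 0)"
      by (intro tendsto_intros)
    ultimately have "((\<lambda>x. poly (?c * w) x * (x * ln x)) \<longlongrightarrow> poly (?c * w) 0 * 0) (at_right 0)"
      by (rule tendsto_mult[rotated])
    then have "((\<lambda>x. poly (?D * w) x * ln x) \<longlongrightarrow> 0) (at_right 0)"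
      by (simp add: algebra_simps)
    then show "(((\<lambda>x. poly (?D * w) x * ln x) \<circ> real_of_ereal) \<longlongrightarrow> 0) (at_right 0)"
      unfolding zero_ereal_def ereal_tendsto_simps .
    have "((\<lambda>x. poly (?D * w) x * ln x) \<longlongrightarrow> poly (?D * w) 1 * ln 1) (at_left 1)"
      by (intro tendsto_intros) auto
    then show "(((\<lambda>x. poly (?D * w) x * ln x) \<circ> real_of_ereal) \<longlongrightarrow> 0) (at_left 1)"
      unfolding one_ereal_def ereal_tendsto_simps by simp
    show "set_integrable lborel (einterval 0 1)
        (\<lambda>x. poly (pderiv (?D * w)) x * ln x + poly (?c * w) x)"
      using sum by (simp add: interval_lebesgue_integrable_def)
  qed simp
  also have "(LBINT x=0..1. poly (pderiv (?D * w)) x * ln x + poly (?c * w) x) =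
      (LBINT x=0..1. poly (pderiv (?D * w)) x * ln x) + unit_integral (?c * w)"
    unfolding unit_integral_def
    by (intro interval_lebesgue_integral_add(2) interval_integrable_poly_ln interval_integrable_poly)
  finally show ?thesis
    by simp
qed

section \<open>Evaluation for distinct indices\<close>

lemma legendre_log_integral_commute: "legendre_log_integral n m = legendre_log_integral m n"
  by (simp add: legendre_log_integral_def mult.commute mult.left_commute)

lemma legendre_log_integral_less:
  assumes "m < n"
  shows "legendre_log_integral n m =
           (- 1) ^ (n + m + 1) / ((real n - real m) * (real n + real m + 1))"
proof -
  let ?q = "shifted_legendre n" and ?r = "shifted_legendre m" and ?D = "[:0, -1, 1:] :: real poly"
  let ?l = "(real n - real m) * (real n + real m + 1)"
  let ?w = "pderiv ?q * ?r - pderiv ?r * ?q"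
  \<comment> \<open>The terms \<open>?D * pderiv ?q * pderiv ?r\<close> cancel, so Legendre's
    equation leaves the difference of the eigenvalues, n(n + 1) - m(m + 1) = (n - m)(n + m +
    1).\<close>
  have "pderiv (?D * ?w) = pderiv (?D * pderiv ?q) * ?r - pderiv (?D * pderiv ?r) * ?q"
    unfolding pderiv_diff pderiv_mult by algebra
  also have "\<dots> = smult ?l (?q * ?r)"
    unfolding shifted_legendre_ode
    by (simp add: algebra_simps smult_diff_left smult_add_left)
  finally have "?l * legendre_log_integral n m = (LBINT x=0..1. poly (pderiv (?D * ?w)) x * ln x)"
    by (simp add: legendre_log_integral_def poly_shifted_legendre mult.assoc)
  also have "\<dots> = (-1) ^ (n + m + 1)"
    unfolding integral_pderiv_ln unit_integral_wronskian[OF assms] by simp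
  finally show ?thesis
    using assms by (subst nonzero_eq_divide_eq) (auto simp: mult.commute)
qed

theorem corollary1:
  fixes n m :: nat
  assumes "n \<noteq> m"
  shows "legendre_log_integral n m =
           (- 1) ^ (n + m + 1) / (\<bar>real n - real m\<bar> * (real n + real m + 1))"
proof (cases "m < n")
  case True
  then show ?thesis
    by (simp add: legendre_log_integral_less)
next
  case False
  with assms have "n < m" by simp
  then show ?thesis
    using legendre_log_integral_less[of n m]
    by (simp add: legendre_log_integral_commute[of n m] add.commute)
qed

end
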